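(* Let $\mathbb{X},\mathbb{Y}$ be real Banach spaces. Let $T\in S_{\mathbb{L}(\mathbb{X},\mathbb{Y})}$ be such that $M_T\neq\emptyset$. Suppose $\sup\{\|Tz\|:z\in C\}<1$ holds for each closed subset $C$ of $S_{\mathbb{X}}$ with $d(M_T,C)>0$. Then given any $\delta>0$, there exists $\epsilon_0>0$ such that for $0<\epsilon<\epsilon_0$, if $A_\epsilon$ is a uniform $\epsilon$-BPB approximation of $T$, then $$M_{A_\epsilon}\subseteq\bigcup_{x\in M_T}B(x,\delta).$$
   Context: $\mathbb{L}(\mathbb{X},\mathbb{Y})$ is the space of bounded linear operators with the operator norm; $S_Z$ is the unit sphere of a normed space $Z$; $B(x,r)$ is the open ball with center $x$ and radius $r$; $d(M,C)=\inf\{\|x-y\|:x\in M,y\in C\}$. For $A\in\mathbb{L}(\mathbb{X},\mathbb{Y})$, $M_A=\{x\in S_{\mathbb{X}}:\|Ax\|=\|A\|\}$. For $T\in S_{\mathbb{L}(\mathbb{X},\mathbb{Y})}$ and $\epsilon>0$, an operator $A\in S_{\mathbb{L}(\mathbb{X},\mathbb{Y})}$ is a uniform $\epsilon$-BPB approximation of $T$ if $\|T-A\|<\epsilon$ and there exists $\delta(\epsilon)>0$ such that for each $x_0\in S_{\mathbb{X}}$ with $\|Tx_0\|>1-\delta(\epsilon)$ there exists $u_0\in M_A$ with $\|u_0-x_0\|<\epsilon$. *)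

theory Defs
  imports "HOL-Analysis.Analysis"
begin

definition norm_attainment_set :: "('a::real_normed_vector \<Rightarrow>\<^sub>L 'b::real_normed_vector) \<Rightarrow> 'a set" where
  "norm_attainment_set A = {x \<in> sphere 0 1. norm (blinfun_apply A x) = norm A}"

(* T of norm one and \<epsilon> > 0 are presupposed by the notion and are supplied by its users. *)
definition uniform_BPB_approx ::
  "real \<Rightarrow> ('a::real_normed_vector \<Rightarrow>\<^sub>L 'b::real_normed_vector) \<Rightarrow> ('a \<Rightarrow>\<^sub>L 'b) \<Rightarrow> bool" where
  "uniform_BPB_approx \<epsilon> T A \<longleftrightarrow>
     A \<in> sphere 0 1 \<and> norm (T - A) < \<epsilon> \<and>
     (\<exists>\<delta>>0. \<forall>x\<^sub>0 \<in> sphere 0 1. norm (blinfun_apply T x\<^sub>0) > 1 - \<delta> \<longrightarrow>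
        (\<exists>u\<^sub>0 \<in> norm_attainment_set A. norm (u\<^sub>0 - x\<^sub>0) < \<epsilon>))"

end

theory Submission
  imports Defs
begin

text \<open>Let \<open>C\<close> be the part of the unit sphere at distance at least \<delta> from
  every point of \<open>norm_attainment_set T\<close>. It is closed and, if nonempty, at positive
  distance from that set, so \<open>norm (T z)\<close> has a supremum s < 1 on \<open>C\<close>. A
  norm-one operator A attaining its norm at u in \<open>C\<close> satisfies 1 - s \<le>
  \<open>norm (A u) - norm (T u)\<close> \<le> \<open>norm (T - A)\<close>. This is impossible if
  \<open>norm (T - A)\<close> < \<epsilon> < 1 - s, so the gap 1 - s serves as the threshold for
  \<epsilon>.\<close>

theorem theorem3p9:
  fixes T :: "'a::banach \<Rightarrow>\<^sub>L 'b::banach"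
  assumes "T \<in> sphere 0 1"
    and "norm_attainment_set T \<noteq> {}"
    and "\<And>C. \<lbrakk>C \<subseteq> sphere 0 1; closed C; setdist (norm_attainment_set T) C > 0\<rbrakk>
           \<Longrightarrow> (SUP z\<in>C. norm (blinfun_apply T z)) < 1"
  shows "\<forall>\<delta>>0. \<exists>\<epsilon>\<^sub>0>0. \<forall>\<epsilon>. 0 < \<epsilon> \<and> \<epsilon> < \<epsilon>\<^sub>0 \<longrightarrow>
           (\<forall>A. uniform_BPB_approx \<epsilon> T A \<longrightarrow>
              norm_attainment_set A \<subseteq> (\<Union>x\<in>norm_attainment_set T. ball x \<delta>))"
proof (intro allI impI)
  fix \<delta> :: real
  assume "\<delta> > 0"
  let ?M = "norm_attainment_set T"
  define C where "C = sphere 0 1 - (\<Union>x\<in>?M. ball x \<delta>)"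
  define s where "s = (SUP z\<in>C. norm (T z))"
  have "closed (cball (0::'a) 1 - ball 0 1)"
    by (intro closed_Diff closed_cball open_ball)
  then have "closed (sphere (0::'a) 1)"
    by (simp only: cball_diff_eq_sphere)
  then have C: "C \<subseteq> sphere 0 1" "closed C"
    unfolding C_def by (auto intro!: closed_Diff)
  \<comment> \<open>A real supremum is known to dominate the values only when they are bounded
    above; the estimate of \<open>norm (T u)\<close> by \<open>s\<close> rests on this.\<close>
  have bdd: "bdd_above ((\<lambda>z. norm (T z)) ` C)"
  proof (rule bdd_aboveI2)
    fix z assume "z \<in> C"
    then show "norm (T z) \<le> norm T"
      using norm_blinfun[of T z] C(1) by auto
  qed
  \<comment> \<open>The case \<open>C = {}\<close> is separate because \<open>setdist ?M {} = 0\<close>.\<close>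
  have s: "s < 1" if "C \<noteq> {}"
  proof -
    \<comment> \<open>Points of \<open>C\<close> lie outside every ball of radius \<delta> around
      \<open>?M\<close>, and both sets are nonempty, so the infimum of distances is at least
      \<delta>.\<close>
    have "\<delta> \<le> setdist ?M C"
      using that assms(2) by (subst le_setdist_iff) (auto simp: C_def not_less)
    with \<open>\<delta> > 0\<close> show ?thesis
      unfolding s_def by (intro assms(3) C) simp
  qed
  \<comment> \<open>For empty \<open>C\<close> the value \<open>s\<close> carries no information;
    any positive threshold then works, since the bad point \<open>u\<close> below would lie in
    \<open>C\<close>.\<close>
  define e where "e = (if C = {} then 1 else 1 - s)"
  have "norm_attainment_set A \<subseteq> (\<Union>x\<in>?M. ball x \<delta>)"
    if "\<epsilon> < e" and A: "uniform_BPB_approx \<epsilon> T A" for \<epsilon> A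
  proof (rule subsetI, rule ccontr)
    fix u
    assume u: "u \<in> norm_attainment_set A" and "u \<notin> (\<Union>x\<in>?M. ball x \<delta>)"
    have norms: "norm u = 1" "norm (A u) = 1" "norm (T - A) < \<epsilon>"
      using u A by (auto simp: norm_attainment_set_def uniform_BPB_approx_def)
    have "u \<in> C"
      using \<open>u \<notin> _\<close> norms(1) by (simp add: C_def)
    then have "norm (T u) \<le> s"
      unfolding s_def by (rule cSUP_upper[OF _ bdd])
    \<comment> \<open>Reverse triangle inequality, then the operator norm bound for
      \<open>T - A\<close> at the unit vector \<open>u\<close>.\<close>
    moreover have "norm (A u) - norm (T u) \<le> norm (T - A)"
      using norm_blinfun[of "T - A" u] norm_triangle_ineq3[of "T u" "A u"] norms(1)
      by (simp add: blinfun.diff_left)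
    moreover have "\<epsilon> < 1 - s"
      using \<open>\<epsilon> < e\<close> \<open>u \<in> C\<close> by (auto simp: e_def split: if_splits)
    ultimately show False
      using norms by linarith
  qed
  moreover have "e > 0"
    using s by (simp add: e_def)
  ultimately show "\<exists>\<epsilon>\<^sub>0>0. \<forall>\<epsilon>. 0 < \<epsilon> \<and> \<epsilon> < \<epsilon>\<^sub>0 \<longrightarrow>
      (\<forall>A. uniform_BPB_approx \<epsilon> T A \<longrightarrow>
        norm_attainment_set A \<subseteq> (\<Union>x\<in>?M. ball x \<delta>))"
    by blast
qed

end
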